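(* Conferencing may enable secure transmission if this is not possible without, in the following sense. There are wiretap multiple-access channels $W:\mathcal X\times\mathcal Y\to\mathcal P(\mathcal T\times\mathcal Z)$ with finite alphabets for which, with the definitions of the context, the achievable region without conferencing, $$\mathrm{closure}\Bigl(\mathrm{conv}\Bigl(\bigcup_{p\in\Pi_0}\mathcal R^{(0)}(p)\Bigr)\Bigr),$$ contains only the rate pair $(0,0)$, whereas with conferencing capacities $C_1,C_2>0$ the achievable region, i.e. the closure of the convex hull of $$\bigcup_{p\in\Pi^{(1)}_{C_1+C_2}}\mathcal R^{(1)}(p,C_1,C_2)\cup\bigcup_{p\in\Pi^{(2)}_{C_1+C_2}}\mathcal R^{(2)}(p,C_1,C_2)\cup\bigcup_{p\in\Pi^{(3)}_{C_1+C_2}}\mathcal R^{(3)}(p,C_1,C_2),$$ contains non-trivial rate pairs (i.e. pairs other than $(0,0)$).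
   Context: Both regions are inner bounds (regions of rate pairs shown to be achievable with strong secrecy against an eavesdropper observing the $\mathcal Z$-output), not known to be the full capacity regions. Notation: $[x]_+=\max\{x,0\}$; $\mathcal P(\mathcal S)$ is the set of probability distributions on the finite set $\mathcal S$; stochastic matrices are written as maps into $\mathcal P(\cdot)$; $I(A\wedge B)$, $I(A\wedge B|C)$ denote (conditional) mutual information. $\mathcal X,\mathcal Y$ are the input alphabets of the two senders, $\mathcal T$ is the output alphabet of the legitimate receiver, $\mathcal Z$ that of the eavesdropper. The set $\Pi$. $\Pi$ is the set of all distributions $p$ of random vectors $(U,V_1,V_2,X,Y,T,Z)$ on $\mathcal U\times\mathcal V_1\times\mathcal V_2\times\mathcal X\times\mathcal Y\times\mathcal T\times\mathcal Z$, with $\mathcal U,\mathcal V_1,\mathcal V_2$ finite subsets of the integers, of the form $p=P_U\otimes P_{V_1|U}\otimes P_{V_2|U}\otimes P_{X|V_1}\otimes P_{Y|V_2}\otimes W$. For $p\in\Pi$ write $t_1=I(T\wedge V_1|V_2U)$, $t_2=I(T\wedge V_2|V_1U)$, $t_{12}=I(T\wedge V_1V_2|U)$, $t_{012}=I(T\wedge V_1V_2)$, $z_0=I(Z\wedge U)$, $z_1=I(Z\wedge V_1|U)$, $z_2=I(Z\wedge V_2|U)$, $z_{12}=I(Z\wedge V_1V_2|U)$, $z_{012}=I(Z\wedge V_1V_2)$, $a=I(Z\wedge V_1|V_2U)$, $b=I(Z\wedge V_2|V_1U)$. All the sets $\Pi_0,\Pi^{(\nu)}_{H_C}$ additionally require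 $z_{012}\le t_{012}$. All regions consist of nonnegative real pairs $(R_1,R_2)$. $\Pi_0$: those $p\in\Pi$ for which $V_1,V_2$ are independent of $U$ (so $U$ can be omitted and $V_1,V_2$ are independent) and $I(Z\wedge V_1)\le I(T\wedge V_1|V_2)$, $I(Z\wedge V_2)\le I(T\wedge V_2|V_1)$. $\mathcal R^{(0)}(p)$: $R_1\le I(T\wedge V_1|V_2)-I(Z\wedge V_1)-[I(Z\wedge V_2|V_1)-I(T\wedge V_2|V_1)]_+$, $R_2\le I(T\wedge V_2|V_1)-I(Z\wedge V_2)-[I(Z\wedge V_1|V_2)-I(T\wedge V_1|V_2)]_+$, $R_1+R_2\le I(T\wedge V_1V_2)-I(Z\wedge V_1V_2)$. For $C_1,C_2>0$ put $H_C=C_1+C_2$. Case 1. $\Pi^{(1)}_{H_C}$: those $p\in\Pi$ with $z_0<H_C$, $z_1\le t_1$, $z_2\le t_2$, $z_{12}\le t_1+t_2$. $\mathcal R^{(1)}(p,C_1,C_2)$: $R_1\le t_1-z_1-[b-t_2]_++C_1-[z_0-C_2]_+$, $R_2\le t_2-z_2-[a-t_1]_++C_2-[z_0-C_1]_+$, $R_1+R_2\le\min\{t_{12}+C_1+C_2,\,t_{012}\}-z_{012}$. Case 2. $\Pi^{(2)}_{H_C}$: those $p\in\Pi$ with $\min\{I(Z\wedge V_1U),I(Z\wedge V_2U)\}<H_C\le z_{012}$ which, if $a\ne b$, satisfy in addition $\alpha^{(2)}_0\le\alpha^{(2)}_1$, where if $a>b$, $\alpha^{(2)}_0=\max\bigl(\frac{I(Z\wedge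 V_1U)-H_C}{a-b},1-\frac{t_2}{b},0\bigr)$, $\alpha^{(2)}_1=\min\bigl(\frac{t_1}{a},\frac{t_{12}-b}{a-b},1\bigr)$; if $a<b$, $\alpha^{(2)}_0=\max\bigl(1-\frac{t_2}{b},\frac{t_{12}-b}{a-b},0\bigr)$, $\alpha^{(2)}_1=\min\bigl(\frac{H_C-I(Z\wedge V_1U)}{b-a},\frac{t_1}{a},1\bigr)$. With $J_0^{(\alpha)}=\alpha I(Z\wedge V_2U)+(1-\alpha)I(Z\wedge V_1U)$, for $\alpha\in[\alpha^{(2)}_0,\alpha^{(2)}_1]$ let $\mathcal R^{(2)}_\alpha(p,C_1,C_2)$ be given by $R_1\le t_1-\alpha a+C_1-[J_0^{(\alpha)}-C_2]_+$, $R_2\le t_2-(1-\alpha)b+C_2-[J_0^{(\alpha)}-C_1]_+$, $R_1+R_2\le\min\{t_{12}+C_1+C_2,\,t_{012}\}-z_{012}$; and $\mathcal R^{(2)}(p,C_1,C_2)=\bigcup_{\alpha^{(2)}_0\le\alpha\le\alpha^{(2)}_1}\mathcal R^{(2)}_\alpha(p,C_1,C_2)$. The union over $\Pi^{(2)}_{C_1+C_2}$ in the claim runs over those $p$ for which $\alpha_0^{(2)},\alpha_1^{(2)}$ are defined by these formulas. Case 3. $\Pi^{(3)}_{H_C}$: those $p\in\Pi$ with $z_{012}<H_C$. $\mathcal R^{(3)}(p,C_1,C_2)$: $R_1\le t_1+C_1-[z_{012}-C_2]_+$, $R_2\le t_2+C_2-[z_{012}-C_1]_+$, $R_1+R_2\le\min\{t_{12}+C_1+C_2,\,t_{012}\}-z_{012}$.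 *)

theory Defs
  imports "HOL-Probability.Probability"
begin

(* Channel alphabets are finite nonempty sets of natural numbers, which covers every finite
   alphabet up to renaming and lets the existence of a channel quantify over its alphabets too.
   A stochastic matrix is a function into probability mass functions; its values at arguments
   outside the alphabets are never used. *)

definition wiretap_mac ::
  "nat set \<Rightarrow> nat set \<Rightarrow> nat set \<Rightarrow> nat set \<Rightarrow> (nat \<Rightarrow> nat \<Rightarrow> (nat \<times> nat) pmf) \<Rightarrow> bool"
where
  "wiretap_mac \<X> \<Y> \<T> \<Z> W \<longleftrightarrow>
     finite \<X> \<and> finite \<Y> \<and> finite \<T> \<and> finite \<Z> \<and>
     \<X> \<noteq> {} \<and> \<Y> \<noteq> {} \<and> \<T> \<noteq> {} \<and> \<Z> \<noteq> {} \<and>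
     (\<forall>x\<in>\<X>. \<forall>y\<in>\<Y>. set_pmf (W x y) \<subseteq> \<T> \<times> \<Z>)"

(* values of the random vector (U, V1, V2, X, Y, T, Z) *)
type_synonym outcome = "int \<times> int \<times> int \<times> nat \<times> nat \<times> nat \<times> nat"

definition rvU :: "outcome \<Rightarrow> int" where "rvU = (\<lambda>(u, v1, v2, x, y, t, z). u)"
definition rvV1 :: "outcome \<Rightarrow> int" where "rvV1 = (\<lambda>(u, v1, v2, x, y, t, z). v1)"
definition rvV2 :: "outcome \<Rightarrow> int" where "rvV2 = (\<lambda>(u, v1, v2, x, y, t, z). v2)"
definition rvT :: "outcome \<Rightarrow> nat" where "rvT = (\<lambda>(u, v1, v2, x, y, t, z). t)"
definition rvZ :: "outcome \<Rightarrow> nat" where "rvZ = (\<lambda>(u, v1, v2, x, y, t, z). z)"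

abbreviation rv_pair :: "('o \<Rightarrow> 'a) \<Rightarrow> ('o \<Rightarrow> 'b) \<Rightarrow> 'o \<Rightarrow> 'a \<times> 'b"
where "rv_pair A B \<equiv> (\<lambda>\<omega>. (A \<omega>, B \<omega>))"

(* the law P_U (x) P_{V1|U} (x) P_{V2|U} (x) P_{X|V1} (x) P_{Y|V2} (x) W *)
definition joint_law ::
  "(nat \<Rightarrow> nat \<Rightarrow> (nat \<times> nat) pmf) \<Rightarrow> int pmf \<Rightarrow> (int \<Rightarrow> int pmf) \<Rightarrow> (int \<Rightarrow> int pmf) \<Rightarrow>
   (int \<Rightarrow> nat pmf) \<Rightarrow> (int \<Rightarrow> nat pmf) \<Rightarrow> outcome pmf"
where
  "joint_law W PU PV1 PV2 PX PY =
     bind_pmf PU (\<lambda>u. bind_pmf (PV1 u) (\<lambda>v1. bind_pmf (PV2 u) (\<lambda>v2.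
       bind_pmf (PX v1) (\<lambda>x. bind_pmf (PY v2) (\<lambda>y.
         map_pmf (\<lambda>(t, z). (u, v1, v2, x, y, t, z)) (W x y))))))"

definition Pi_set ::
  "nat set \<Rightarrow> nat set \<Rightarrow> (nat \<Rightarrow> nat \<Rightarrow> (nat \<times> nat) pmf) \<Rightarrow> outcome pmf set"
where
  "Pi_set \<X> \<Y> W = {joint_law W PU PV1 PV2 PX PY | PU PV1 PV2 PX PY.
     \<exists>\<U> \<V>\<^sub>1 \<V>\<^sub>2. finite \<U> \<and> finite \<V>\<^sub>1 \<and> finite \<V>\<^sub>2 \<and>
       set_pmf PU \<subseteq> \<U> \<and>
       (\<forall>u\<in>\<U>. set_pmf (PV1 u) \<subseteq> \<V>\<^sub>1 \<and> set_pmf (PV2 u) \<subseteq> \<V>\<^sub>2) \<and>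
       (\<forall>v\<in>\<V>\<^sub>1. set_pmf (PX v) \<subseteq> \<X>) \<and>
       (\<forall>v\<in>\<V>\<^sub>2. set_pmf (PY v) \<subseteq> \<Y>)}"

(* Rates are measured in bits. *)

definition MI :: "'o pmf \<Rightarrow> ('o \<Rightarrow> 'a) \<Rightarrow> ('o \<Rightarrow> 'b) \<Rightarrow> real"
where
  "MI p A B = prob_space.mutual_information (measure_pmf p) 2
     (count_space UNIV) (count_space UNIV) A B"

(* CMI p A B C is I(A \<and> B | C) *)
definition CMI :: "'o pmf \<Rightarrow> ('o \<Rightarrow> 'a) \<Rightarrow> ('o \<Rightarrow> 'b) \<Rightarrow> ('o \<Rightarrow> 'c) \<Rightarrow> real"
where
  "CMI p A B C = prob_space.conditional_mutual_information (measure_pmf p) 2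
     (count_space UNIV) (count_space UNIV) (count_space UNIV) A B C"

definition indep_rv :: "'o pmf \<Rightarrow> ('o \<Rightarrow> 'a) \<Rightarrow> ('o \<Rightarrow> 'a) \<Rightarrow> bool"
where
  "indep_rv p A B \<longleftrightarrow>
     prob_space.indep_var (measure_pmf p) (count_space UNIV) A (count_space UNIV) B"

definition t1 where "t1 p = CMI p rvT rvV1 (rv_pair rvV2 rvU)"
definition t2 where "t2 p = CMI p rvT rvV2 (rv_pair rvV1 rvU)"
definition t12 where "t12 p = CMI p rvT (rv_pair rvV1 rvV2) rvU"
definition t012 where "t012 p = MI p rvT (rv_pair rvV1 rvV2)"
definition z0 where "z0 p = MI p rvZ rvU"
definition z1 where "z1 p = CMI p rvZ rvV1 rvU"
definition z2 where "z2 p = CMI p rvZ rvV2 rvU"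
definition z12 where "z12 p = CMI p rvZ (rv_pair rvV1 rvV2) rvU"
definition z012 where "z012 p = MI p rvZ (rv_pair rvV1 rvV2)"
definition za where "za p = CMI p rvZ rvV1 (rv_pair rvV2 rvU)"
definition zb where "zb p = CMI p rvZ rvV2 (rv_pair rvV1 rvU)"
definition zV1U where "zV1U p = MI p rvZ (rv_pair rvV1 rvU)"
definition zV2U where "zV2U p = MI p rvZ (rv_pair rvV2 rvU)"

definition pos_part :: "real \<Rightarrow> real" where "pos_part x = max x 0"

definition Pi0 ::
  "nat set \<Rightarrow> nat set \<Rightarrow> (nat \<Rightarrow> nat \<Rightarrow> (nat \<times> nat) pmf) \<Rightarrow> outcome pmf set"
where
  "Pi0 \<X> \<Y> W = {p \<in> Pi_set \<X> \<Y> W.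
     z012 p \<le> t012 p \<and>
     indep_rv p rvV1 rvU \<and> indep_rv p rvV2 rvU \<and>
     MI p rvZ rvV1 \<le> CMI p rvT rvV1 rvV2 \<and>
     MI p rvZ rvV2 \<le> CMI p rvT rvV2 rvV1}"

definition Region0 :: "outcome pmf \<Rightarrow> (real \<times> real) set"
where
  "Region0 p = {(R1, R2). 0 \<le> R1 \<and> 0 \<le> R2 \<and>
     R1 \<le> CMI p rvT rvV1 rvV2 - MI p rvZ rvV1
            - pos_part (CMI p rvZ rvV2 rvV1 - CMI p rvT rvV2 rvV1) \<and>
     R2 \<le> CMI p rvT rvV2 rvV1 - MI p rvZ rvV2
            - pos_part (CMI p rvZ rvV1 rvV2 - CMI p rvT rvV1 rvV2) \<and>
     R1 + R2 \<le> MI p rvT (rv_pair rvV1 rvV2) - MI p rvZ (rv_pair rvV1 rvV2)}"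

definition Pi1 ::
  "nat set \<Rightarrow> nat set \<Rightarrow> (nat \<Rightarrow> nat \<Rightarrow> (nat \<times> nat) pmf) \<Rightarrow> real \<Rightarrow> outcome pmf set"
where
  "Pi1 \<X> \<Y> W H = {p \<in> Pi_set \<X> \<Y> W.
     z012 p \<le> t012 p \<and>
     z0 p < H \<and> z1 p \<le> t1 p \<and> z2 p \<le> t2 p \<and> z12 p \<le> t1 p + t2 p}"

definition Region1 :: "outcome pmf \<Rightarrow> real \<Rightarrow> real \<Rightarrow> (real \<times> real) set"
where
  "Region1 p C1 C2 = {(R1, R2). 0 \<le> R1 \<and> 0 \<le> R2 \<and>
     R1 \<le> t1 p - z1 p - pos_part (zb p - t2 p) + C1 - pos_part (z0 p - C2) \<and>
     R2 \<le> t2 p - z2 p - pos_part (za p - t1 p) + C2 - pos_part (z0 p - C1) \<and>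
     R1 + R2 \<le> min (t12 p + C1 + C2) (t012 p) - z012 p}"

(* The formulas defining alpha0 and alpha1 make sense only under alpha_defined: the cases are
   a > b and a < b, and both of them divide by a or b. *)
definition alpha_defined :: "outcome pmf \<Rightarrow> bool"
where "alpha_defined p \<longleftrightarrow> za p \<noteq> zb p \<and> za p \<noteq> 0 \<and> zb p \<noteq> 0"

definition alpha0 :: "outcome pmf \<Rightarrow> real \<Rightarrow> real"
where
  "alpha0 p H =
     (if za p > zb p
      then Max {(zV1U p - H) / (za p - zb p), 1 - t2 p / zb p, 0}
      else Max {1 - t2 p / zb p, (t12 p - zb p) / (za p - zb p), 0})"

definition alpha1 :: "outcome pmf \<Rightarrow> real \<Rightarrow> real"
where
  "alpha1 p H =
     (if za p > zb p
      then Min {t1 p / za p, (t12 p - zb p) / (za p - zb p), 1}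
      else Min {(H - zV1U p) / (zb p - za p), t1 p / za p, 1})"

definition Pi2 ::
  "nat set \<Rightarrow> nat set \<Rightarrow> (nat \<Rightarrow> nat \<Rightarrow> (nat \<times> nat) pmf) \<Rightarrow> real \<Rightarrow> outcome pmf set"
where
  "Pi2 \<X> \<Y> W H = {p \<in> Pi_set \<X> \<Y> W.
     z012 p \<le> t012 p \<and>
     min (zV1U p) (zV2U p) < H \<and> H \<le> z012 p \<and>
     (za p \<noteq> zb p \<longrightarrow> alpha0 p H \<le> alpha1 p H)}"

definition J0 :: "outcome pmf \<Rightarrow> real \<Rightarrow> real"
where "J0 p \<alpha> = \<alpha> * zV2U p + (1 - \<alpha>) * zV1U p"

definition Region2_alpha :: "real \<Rightarrow> outcome pmf \<Rightarrow> real \<Rightarrow> real \<Rightarrow> (real \<times> real) set"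
where
  "Region2_alpha \<alpha> p C1 C2 = {(R1, R2). 0 \<le> R1 \<and> 0 \<le> R2 \<and>
     R1 \<le> t1 p - \<alpha> * za p + C1 - pos_part (J0 p \<alpha> - C2) \<and>
     R2 \<le> t2 p - (1 - \<alpha>) * zb p + C2 - pos_part (J0 p \<alpha> - C1) \<and>
     R1 + R2 \<le> min (t12 p + C1 + C2) (t012 p) - z012 p}"

definition Region2 :: "outcome pmf \<Rightarrow> real \<Rightarrow> real \<Rightarrow> (real \<times> real) set"
where
  "Region2 p C1 C2 = (\<Union>\<alpha>\<in>{alpha0 p (C1 + C2)..alpha1 p (C1 + C2)}. Region2_alpha \<alpha> p C1 C2)"

definition Pi3 ::
  "nat set \<Rightarrow> nat set \<Rightarrow> (nat \<Rightarrow> nat \<Rightarrow> (nat \<times> nat) pmf) \<Rightarrow> real \<Rightarrow> outcome pmf set"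
where
  "Pi3 \<X> \<Y> W H = {p \<in> Pi_set \<X> \<Y> W. z012 p \<le> t012 p \<and> z012 p < H}"

definition Region3 :: "outcome pmf \<Rightarrow> real \<Rightarrow> real \<Rightarrow> (real \<times> real) set"
where
  "Region3 p C1 C2 = {(R1, R2). 0 \<le> R1 \<and> 0 \<le> R2 \<and>
     R1 \<le> t1 p + C1 - pos_part (z012 p - C2) \<and>
     R2 \<le> t2 p + C2 - pos_part (z012 p - C1) \<and>
     R1 + R2 \<le> min (t12 p + C1 + C2) (t012 p) - z012 p}"

definition region_without_conferencing ::
  "nat set \<Rightarrow> nat set \<Rightarrow> (nat \<Rightarrow> nat \<Rightarrow> (nat \<times> nat) pmf) \<Rightarrow> (real \<times> real) set"
where
  "region_without_conferencing \<X> \<Y> W = closure (convex hull (\<Union>p\<in>Pi0 \<X> \<Y> W. Region0 p))"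

definition region_with_conferencing ::
  "nat set \<Rightarrow> nat set \<Rightarrow> (nat \<Rightarrow> nat \<Rightarrow> (nat \<times> nat) pmf) \<Rightarrow> real \<Rightarrow> real \<Rightarrow> (real \<times> real) set"
where
  "region_with_conferencing \<X> \<Y> W C1 C2 = closure (convex hull (
     (\<Union>p\<in>Pi1 \<X> \<Y> W (C1 + C2). Region1 p C1 C2) \<union>
     (\<Union>p\<in>{p \<in> Pi2 \<X> \<Y> W (C1 + C2). alpha_defined p}. Region2 p C1 C2) \<union>
     (\<Union>p\<in>Pi3 \<X> \<Y> W (C1 + C2). Region3 p C1 C2)))"

end

(* The legitimate receiver sees a binary symmetric version T of Y, the eavesdropper sees
   Z = X + Y. If X is independent of Y with P(X = 1) = q, then Z - q is an unbiased estimate of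
   Y, so T is stochastically degraded from Z by a kernel depending only on q; hence
   I(T;V1V2) <= I(Z;V1V2) whenever V1 and V2 are independent, and every rate sum is at most 0.
   Conferencing lets the senders use X = 1 - Y: then Z is constant, while T still carries
   information about Y. *)

theory Submission
  imports Defs
begin

text \<open>The noise in T is essential. If T were Y itself, a uniform X independent of Y, with V1
  constant and V2 = Y, would leave the eavesdropper half a bit about Y against the receiver's full
  bit, so a positive rate would be possible without conferencing. The parameter q of the degrading
  kernel is P(X = 1 | V1 = a) and varies with a. So T is degraded from Z only conditionally on V1,
  and data processing does not apply to Z alone. What holds is I(T;V1V2) = I(T;V2) = I(T;V2|V1)
  \<le> I(Z;V2|V1) \<le> I(Z;V1V2), where the first two equalities use that T ignores X and that V1,
  V2 are independent. The proof obtains the outer inequality in a single estimate, without the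
  intermediate quantities. With conferencing, Z is constant, so all leakage terms of the third case
  vanish and one law serves every pair of capacities.\<close>

section \<open>Mutual information of discrete variables as finite sums\<close>

lemma sets_pair_measure_pmf:
  fixes P :: "'a::countable pmf" and Q :: "'b::countable pmf"
  shows "sets (measure_pmf P \<Otimes>\<^sub>M measure_pmf Q) = UNIV"
proof -
  have "sets (measure_pmf P \<Otimes>\<^sub>M measure_pmf Q)
      = sets (count_space (UNIV::'a set) \<Otimes>\<^sub>M count_space (UNIV::'b set))"
    by (rule sets_pair_measure_cong) auto
  also have "\<dots> = UNIV"
    by (subst pair_measure_countable) auto
  finally show ?thesis .
qed

lemma pair_measure_pmf:
  fixes P :: "'a::countable pmf" and Q :: "'b::countable pmf"
  shows "measure_pmf P \<Otimes>\<^sub>M measure_pmf Q = measure_pmf (pair_pmf P Q)"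
proof (rule measure_eqI_countable[where A = UNIV])
  fix ab :: "'a \<times> 'b"
  obtain a b where ab: "ab = (a, b)" by fastforce
  have "emeasure (measure_pmf P \<Otimes>\<^sub>M measure_pmf Q) ({a} \<times> {b}) = pmf P a * pmf Q b"
    by (subst measure_pmf.emeasure_pair_measure_Times)
      (auto simp: emeasure_pmf_single ennreal_mult)
  then show "emeasure (measure_pmf P \<Otimes>\<^sub>M measure_pmf Q) {ab} = emeasure (pair_pmf P Q) {ab}"
    by (simp add: ab emeasure_pmf_single pmf_pair)
qed (auto simp: sets_pair_measure_pmf)

lemma pmf_fst_eq_0: "pmf (map_pmf fst J) a = 0 \<Longrightarrow> pmf J (a, b) = 0"
  by (metis fst_conv image_eqI pmf_eq_0_set_pmf set_map_pmf)

lemma pmf_snd_eq_0: "pmf (map_pmf snd J) b = 0 \<Longrightarrow> pmf J (a, b) = 0"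
  by (metis snd_conv image_eqI pmf_eq_0_set_pmf set_map_pmf)

text \<open>\<open>KL_divergence\<close> takes the reference law first, so this is D(Q||P), and
  \<open>ac\<close> is absolute continuity of \<open>Q\<close> with respect to \<open>P\<close>.
  Points of \<open>S\<close> outside the support of \<open>Q\<close> contribute zero.\<close>

lemma KL_divergence_pmf:
  fixes P Q :: "'a::countable pmf"
  assumes ac: "\<And>x. pmf P x = 0 \<Longrightarrow> pmf Q x = 0"
    and fin: "finite S" "set_pmf Q \<subseteq> S"
  shows "KL_divergence 2 (measure_pmf P) (measure_pmf Q)
    = (\<Sum>x\<in>S. pmf Q x * log 2 (pmf Q x / pmf P x))"
proof -
  interpret sigma_finite_measure "count_space (UNIV :: 'a set)"
    by (rule sigma_finite_measure_count_space)
  have "KL_divergence 2 (measure_pmf P) (measure_pmf Q)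
    = (\<integral>x. pmf Q x * log 2 (pmf Q x / pmf P x) \<partial>count_space UNIV)"
    unfolding measure_pmf_eq_density[of P] measure_pmf_eq_density[of Q]
    by (rule KL_density_density) (auto simp: AE_count_space ac)
  also have "\<dots> = (\<integral>x. log 2 (pmf Q x / pmf P x) \<partial>measure_pmf Q)"
    by (simp add: measure_pmf_eq_density integral_density)
  also have "\<dots> = (\<Sum>x\<in>S. log 2 (pmf Q x / pmf P x) * pmf Q x)"
    using fin by (intro integral_measure_pmf_real) auto
  finally show ?thesis by (simp add: mult.commute)
qed

lemma MI_eq_sum:
  fixes A :: "'o \<Rightarrow> 'a::countable" and B :: "'o \<Rightarrow> 'b::countable"
  assumes fin: "finite S" "finite R" and in_sets: "\<And>\<omega>. \<omega> \<in> set_pmf p \<Longrightarrow> A \<omega> \<in> S \<and> B \<omega> \<in> R"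
  shows "MI p A B = (\<Sum>a\<in>S. \<Sum>b\<in>R. pmf (map_pmf (rv_pair A B) p) (a, b)
    * log 2 (pmf (map_pmf (rv_pair A B) p) (a, b) / (pmf (map_pmf A p) a * pmf (map_pmf B p) b)))"
proof -
  let ?J = "map_pmf (rv_pair A B) p"
  have fst: "map_pmf fst ?J = map_pmf A p" and snd: "map_pmf snd ?J = map_pmf B p"
    by (simp_all add: pmf.map_comp o_def)
  have "MI p A B = KL_divergence 2 (measure_pmf (pair_pmf (map_pmf A p) (map_pmf B p))) (measure_pmf ?J)"
    unfolding MI_def prob_space.mutual_information_def[OF prob_space_measure_pmf]
    by (simp add: pair_measure_countable map_pmf_rep_eq[symmetric] pair_measure_pmf)
  also have "\<dots> = (\<Sum>x\<in>S \<times> R. pmf ?J x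
      * log 2 (pmf ?J x / pmf (pair_pmf (map_pmf A p) (map_pmf B p)) x))"
  proof (rule KL_divergence_pmf)
    fix x assume "pmf (pair_pmf (map_pmf A p) (map_pmf B p)) x = 0"
    then show "pmf ?J x = 0"
      using pmf_fst_eq_0[of ?J "fst x" "snd x"] pmf_snd_eq_0[of ?J "snd x" "fst x"]
      by (cases x) (auto simp: pmf_pair fst snd)
  qed (use fin in_sets in auto)
  finally show ?thesis
    by (simp add: sum.cartesian_product' pmf_pair)
qed

text \<open>The chain rule, which is how \<open>conditional_mutual_information\<close> is defined.
  All conditional quantities are reduced to \<open>MI\<close> through it.\<close>

lemma CMI_eq_MI_diff:
  fixes A :: "'o \<Rightarrow> 'a" and B :: "'o \<Rightarrow> 'b::countable" and C :: "'o \<Rightarrow> 'c::countable"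
  shows "CMI p A B C = MI p A (rv_pair B C) - MI p A C"
  unfolding CMI_def MI_def prob_space.conditional_mutual_information_def[OF prob_space_measure_pmf]
  by (simp add: pair_measure_countable)

lemma MI_const_left:
  fixes A :: "'o \<Rightarrow> 'a::countable" and B :: "'o \<Rightarrow> 'b::countable"
  assumes fin: "finite (set_pmf p)" and const: "\<And>\<omega>. \<omega> \<in> set_pmf p \<Longrightarrow> A \<omega> = a"
  shows "MI p A B = 0"
proof -
  have "map_pmf A p = map_pmf (\<lambda>_. a) p"
    using const by (intro map_pmf_cong) auto
  then have A: "map_pmf A p = return_pmf a" by (simp add: map_pmf_const)
  have "map_pmf (rv_pair A B) p = map_pmf (Pair a) (map_pmf B p)"
    unfolding pmf.map_comp using const by (intro map_pmf_cong) auto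
  then have "pmf (map_pmf (rv_pair A B) p) (a, b) = pmf (map_pmf B p) b" for b
    using pmf_map_inj'[of "Pair a" "map_pmf B p" b] by (simp add: inj_on_def)
  then show ?thesis
    using fin const by (subst MI_eq_sum[where S = "{a}" and R = "B ` set_pmf p"])
      (auto simp: A intro!: sum.neutral)
qed

lemma MI_const_right:
  fixes A :: "'o \<Rightarrow> 'a::countable" and B :: "'o \<Rightarrow> 'b::countable"
  assumes fin: "finite (set_pmf p)" and const: "\<And>\<omega>. \<omega> \<in> set_pmf p \<Longrightarrow> B \<omega> = b"
  shows "MI p A B = 0"
proof -
  have "map_pmf B p = map_pmf (\<lambda>_. b) p"
    using const by (intro map_pmf_cong) auto
  then have B: "map_pmf B p = return_pmf b" by (simp add: map_pmf_const)
  have "map_pmf (rv_pair A B) p = map_pmf (\<lambda>a. (a, b)) (map_pmf A p)"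
    unfolding pmf.map_comp using const by (intro map_pmf_cong) auto
  then have "pmf (map_pmf (rv_pair A B) p) (a, b) = pmf (map_pmf A p) a" for a
    using pmf_map_inj'[of "\<lambda>a. (a, b)" "map_pmf A p" a] by (simp add: inj_on_def)
  then show ?thesis
    using fin const by (subst MI_eq_sum[where S = "A ` set_pmf p" and R = "{b}"])
      (auto simp: B intro!: sum.neutral)
qed

text \<open>Relabelling one variable injectively only reindexes the sum. This later collapses tuples
  built from V1, V2 and U to U alone.\<close>

lemma MI_inj_image:
  fixes A :: "'o \<Rightarrow> 'a::countable" and B :: "'o \<Rightarrow> 'b::countable" and C :: "'o \<Rightarrow> 'c::countable"
  assumes fin: "finite (set_pmf p)" and f: "inj f" and B: "\<And>\<omega>. \<omega> \<in> set_pmf p \<Longrightarrow> B \<omega> = f (C \<omega>)"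
  shows "MI p A B = MI p A C"
proof -
  have "map_pmf B p = map_pmf f (map_pmf C p)"
    unfolding pmf.map_comp using B by (intro map_pmf_cong) auto
  then have 1: "pmf (map_pmf B p) (f c) = pmf (map_pmf C p) c" for c
    using pmf_map_inj'[OF f] by metis
  have g: "inj (map_prod id f)" using f by (simp add: prod.inj_map)
  have "map_pmf (rv_pair A B) p = map_pmf (map_prod id f) (map_pmf (rv_pair A C) p)"
    unfolding pmf.map_comp using B by (intro map_pmf_cong) auto
  then have 2: "pmf (map_pmf (rv_pair A B) p) (a, f c) = pmf (map_pmf (rv_pair A C) p) (a, c)" for a c
    using pmf_map_inj'[OF g, of _ "(a, c)"] by simp
  have "MI p A C = (\<Sum>a\<in>A ` set_pmf p. \<Sum>b\<in>C ` set_pmf p. pmf (map_pmf (rv_pair A C) p) (a, b)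
    * log 2 (pmf (map_pmf (rv_pair A C) p) (a, b) / (pmf (map_pmf A p) a * pmf (map_pmf C p) b)))"
    using fin by (intro MI_eq_sum) auto
  moreover have "MI p A B = (\<Sum>a\<in>A ` set_pmf p. \<Sum>b\<in>f ` C ` set_pmf p. pmf (map_pmf (rv_pair A B) p) (a, b)
    * log 2 (pmf (map_pmf (rv_pair A B) p) (a, b) / (pmf (map_pmf A p) a * pmf (map_pmf B p) b)))"
    using fin B by (intro MI_eq_sum) auto
  ultimately show ?thesis
    using f by (simp add: sum.reindex inj_on_subset[OF f] 1 2)
qed

lemma indep_rv_iff_pair_pmf:
  fixes A B :: "'o \<Rightarrow> 'a::countable"
  shows "indep_rv p A B \<longleftrightarrow> map_pmf (rv_pair A B) p = pair_pmf (map_pmf A p) (map_pmf B p)"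
  unfolding indep_rv_def prob_space.indep_var_distribution_eq[OF prob_space_measure_pmf]
  by (simp add: pair_measure_countable map_pmf_rep_eq[symmetric] pair_measure_pmf
      measure_pmf_inject eq_commute)

lemma indep_rv_const_left:
  fixes A B :: "'o \<Rightarrow> 'a::countable"
  assumes const: "\<And>\<omega>. \<omega> \<in> set_pmf p \<Longrightarrow> A \<omega> = a"
  shows "indep_rv p A B"
proof -
  have "map_pmf A p = map_pmf (\<lambda>_. a) p"
    using const by (intro map_pmf_cong) auto
  moreover have "map_pmf (rv_pair A B) p = map_pmf (Pair a) (map_pmf B p)"
    unfolding pmf.map_comp using const by (intro map_pmf_cong) auto
  ultimately show ?thesis
    by (simp add: indep_rv_iff_pair_pmf map_pmf_const pair_return_pmf1)
qed

section \<open>Divergence estimate for conditional degradation\<close>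

text \<open>
  Apply \<open>ln x \<le> x - 1\<close> to the ratio \<open>r / q\<close> of two laws of \<open>(a, b, z, t)\<close>: in \<open>q\<close>, \<open>t\<close> is
  produced from the true \<open>z\<close> by the degrading kernel; in \<open>r\<close>, \<open>z\<close> is drawn from its marginal
  independently of \<open>a\<close>, and \<open>b\<close> from its posterior given \<open>t\<close>.
\<close>
lemma degraded_sum_le:
  fixes p1 :: "'a \<Rightarrow> real" and p2 :: "'b \<Rightarrow> real" and g :: "'a \<Rightarrow> 'b \<Rightarrow> 'c \<Rightarrow> real"
    and f :: "'b \<Rightarrow> 'd \<Rightarrow> real" and k :: "'a \<Rightarrow> 'c \<Rightarrow> 'd \<Rightarrow> real" and A B
  defines "gz \<equiv> \<lambda>z. \<Sum>a\<in>A. \<Sum>b\<in>B. p1 a * p2 b * g a b z"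
    and "ft \<equiv> \<lambda>t. \<Sum>b\<in>B. p2 b * f b t"
  assumes fin: "finite A" "finite B" "finite C" "finite D"
    and p1: "\<And>a. a \<in> A \<Longrightarrow> 0 < p1 a" "sum p1 A = 1"
    and p2: "\<And>b. b \<in> B \<Longrightarrow> 0 < p2 b" "sum p2 B = 1"
    and g: "\<And>a b z. a \<in> A \<Longrightarrow> b \<in> B \<Longrightarrow> z \<in> C \<Longrightarrow> 0 \<le> g a b z"
      "\<And>a b. a \<in> A \<Longrightarrow> b \<in> B \<Longrightarrow> (\<Sum>z\<in>C. g a b z) = 1"
    and k: "\<And>a z t. a \<in> A \<Longrightarrow> z \<in> C \<Longrightarrow> t \<in> D \<Longrightarrow> 0 \<le> k a z t"
      "\<And>a z. a \<in> A \<Longrightarrow> z \<in> C \<Longrightarrow> (\<Sum>t\<in>D. k a z t) = 1"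
    and f: "\<And>a b t. a \<in> A \<Longrightarrow> b \<in> B \<Longrightarrow> t \<in> D \<Longrightarrow> f b t = (\<Sum>z\<in>C. g a b z * k a z t)"
  shows "(\<Sum>t\<in>D. \<Sum>a\<in>A. \<Sum>b\<in>B. p1 a * p2 b * f b t * ln (f b t / ft t))
    \<le> (\<Sum>z\<in>C. \<Sum>a\<in>A. \<Sum>b\<in>B. p1 a * p2 b * g a b z * ln (g a b z / gz z))"
proof -
  define q where "q a b z t = p1 a * p2 b * g a b z * k a z t" for a b z t
  define r where "r a b z t = p1 a * k a z t * gz z * (p2 b * f b t / ft t)" for a b z t
  \<comment> \<open>\<open>f\<close> does not mention \<open>a\<close>, so its nonnegativity is read
    off from the mixture formula at an arbitrary element of \<open>A\<close>.\<close>
  have [simp]: "A \<noteq> {}" using p1(2) by auto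
  have f0: "0 \<le> f b t" if "b \<in> B" "t \<in> D" for b t
  proof -
    obtain a where "a \<in> A" using \<open>A \<noteq> {}\<close> by blast
    then show ?thesis using that g k f[of a b t] by (auto intro!: sum_nonneg)
  qed
  have ft0: "0 \<le> ft t" if "t \<in> D" for t
    using that f0 p2 unfolding ft_def by (auto intro!: sum_nonneg simp: less_imp_le)
  have gz0: "0 \<le> gz z" if "z \<in> C" for z
    using that g p1 p2 unfolding gz_def by (auto intro!: sum_nonneg simp: less_imp_le)
  have r0: "0 \<le> r a b z t" if "a \<in> A" "b \<in> B" "z \<in> C" "t \<in> D" for a b z t
    using that p1(1)[of a] p2(1)[of b] k(1)[of a z t] gz0[of z] f0[of b t] ft0[of t]
    unfolding r_def by (auto simp: less_imp_le)
  \<comment> \<open>Both sides become expectations under the same weight \<open>q\<close>: here by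
    expanding \<open>f\<close> through the kernel, in \<open>Z\<close> below by inserting the total
    kernel mass 1. Then they can be compared term by term.\<close>
  have T: "(\<Sum>t\<in>D. \<Sum>a\<in>A. \<Sum>b\<in>B. p1 a * p2 b * f b t * ln (f b t / ft t))
    = (\<Sum>a\<in>A. \<Sum>b\<in>B. \<Sum>z\<in>C. \<Sum>t\<in>D. q a b z t * ln (f b t / ft t))"
  proof -
    have "(\<Sum>t\<in>D. \<Sum>a\<in>A. \<Sum>b\<in>B. p1 a * p2 b * f b t * ln (f b t / ft t))
      = (\<Sum>t\<in>D. \<Sum>a\<in>A. \<Sum>b\<in>B. \<Sum>z\<in>C. q a b z t * ln (f b t / ft t))"
    proof (intro sum.cong refl)
      fix t a b assume "t \<in> D" "a \<in> A" "b \<in> B"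
      then have "p1 a * p2 b * f b t * ln (f b t / ft t)
          = p1 a * p2 b * (\<Sum>z\<in>C. g a b z * k a z t) * ln (f b t / ft t)"
        by (subst (1) f[of a b t]) auto
      then show "p1 a * p2 b * f b t * ln (f b t / ft t) = (\<Sum>z\<in>C. q a b z t * ln (f b t / ft t))"
        by (simp add: q_def sum_distrib_left sum_distrib_right mult.assoc)
    qed
    also have "\<dots> = (\<Sum>a\<in>A. \<Sum>t\<in>D. \<Sum>b\<in>B. \<Sum>z\<in>C. q a b z t * ln (f b t / ft t))"
      by (rule sum.swap)
    also have "\<dots> = (\<Sum>a\<in>A. \<Sum>b\<in>B. \<Sum>t\<in>D. \<Sum>z\<in>C. q a b z t * ln (f b t / ft t))"
      by (intro sum.cong refl sum.swap)
    also have "\<dots> = (\<Sum>a\<in>A. \<Sum>b\<in>B. \<Sum>z\<in>C. \<Sum>t\<in>D. q a b z t * ln (f b t / ft t))"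
      by (intro sum.cong refl sum.swap)
    finally show ?thesis .
  qed
  have Z: "(\<Sum>z\<in>C. \<Sum>a\<in>A. \<Sum>b\<in>B. p1 a * p2 b * g a b z * ln (g a b z / gz z))
    = (\<Sum>a\<in>A. \<Sum>b\<in>B. \<Sum>z\<in>C. \<Sum>t\<in>D. q a b z t * ln (g a b z / gz z))"
  proof -
    have "(\<Sum>z\<in>C. \<Sum>a\<in>A. \<Sum>b\<in>B. p1 a * p2 b * g a b z * ln (g a b z / gz z))
      = (\<Sum>a\<in>A. \<Sum>z\<in>C. \<Sum>b\<in>B. p1 a * p2 b * g a b z * ln (g a b z / gz z))"
      by (rule sum.swap)
    also have "\<dots> = (\<Sum>a\<in>A. \<Sum>b\<in>B. \<Sum>z\<in>C. p1 a * p2 b * g a b z * ln (g a b z / gz z))"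
      by (intro sum.cong refl sum.swap)
    also have "\<dots> = (\<Sum>a\<in>A. \<Sum>b\<in>B. \<Sum>z\<in>C. \<Sum>t\<in>D. q a b z t * ln (g a b z / gz z))"
    proof (intro sum.cong refl)
      fix a b z assume *: "z \<in> C" "a \<in> A" "b \<in> B"
      have "(\<Sum>t\<in>D. q a b z t * ln (g a b z / gz z))
          = p1 a * p2 b * g a b z * ln (g a b z / gz z) * (\<Sum>t\<in>D. k a z t)"
        unfolding sum_distrib_left by (intro sum.cong) (simp_all add: q_def)
      then show "p1 a * p2 b * g a b z * ln (g a b z / gz z) = (\<Sum>t\<in>D. q a b z t * ln (g a b z / gz z))"
        using * k by simp
    qed
    finally show ?thesis .
  qed
  have pointwise: "q a b z t * ln (f b t / ft t) - q a b z t * ln (g a b z / gz z) \<le> r a b z t - q a b z t"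
    if *: "a \<in> A" "b \<in> B" "z \<in> C" "t \<in> D" for a b z t
  \<comment> \<open>If \<open>g\<close> or \<open>k\<close> vanishes, so does \<open>q\<close>, and
    \<open>r \<ge> 0\<close> is enough. Otherwise every quantity in the ratio \<open>r / q\<close>
    is positive.\<close>
  proof (cases "g a b z = 0 \<or> k a z t = 0")
    case True
    then have "q a b z t = 0" by (auto simp: q_def)
    then show ?thesis using r0[OF *] by simp
  next
    case False
    then have g': "0 < g a b z" and k': "0 < k a z t" using * g(1)[of a b z] k(1)[of a z t] by auto
    have p': "0 < p1 a" "0 < p2 b" using * p1 p2 by auto
    have "g a b z * k a z t \<le> f b t"
      unfolding f[OF *(1,2,4)] using * fin g k by (intro member_le_sum) auto
    then have f': "0 < f b t" using g' k' by (smt (verit) mult_pos_pos)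
    have "p2 b * f b t \<le> ft t"
      unfolding ft_def using * fin f0 p2 by (intro member_le_sum[of b]) (auto simp: less_imp_le)
    then have ft': "0 < ft t" using f' p' by (smt (verit) mult_pos_pos)
    have "p1 a * p2 b * g a b z \<le> (\<Sum>b\<in>B. p1 a * p2 b * g a b z)"
      using * fin g p1 p2 by (intro member_le_sum[of b]) (auto simp: less_imp_le)
    also have "\<dots> \<le> gz z"
      unfolding gz_def using * fin g p1 p2
      by (intro member_le_sum[of a "A" "\<lambda>a. \<Sum>b\<in>B. p1 a * p2 b * g a b z"])
        (auto simp: less_imp_le intro!: sum_nonneg)
    finally have gz': "0 < gz z" using g' p' by (smt (verit) mult_pos_pos)
    have q': "0 < q a b z t" using g' k' p' by (simp add: q_def)
    have "r a b z t / q a b z t = (f b t / ft t) / (g a b z / gz z)"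
      using f' ft' g' gz' k' p' by (simp add: q_def r_def field_simps)
    then have "ln (f b t / ft t) - ln (g a b z / gz z) = ln (r a b z t / q a b z t)"
      using f' ft' g' gz' by (simp add: ln_divide_pos ln_mult_pos)
    also have "\<dots> \<le> r a b z t / q a b z t - 1"
      using f' ft' gz' k' p' q' by (intro ln_le_minus_one) (auto simp: r_def)
    finally have "q a b z t * (ln (f b t / ft t) - ln (g a b z / gz z)) \<le> q a b z t * (r a b z t / q a b z t - 1)"
      using q' by (intro mult_left_mono) auto
    then show ?thesis using q' by (simp add: right_diff_distrib)
  qed
  have sum_gz: "sum gz C = 1"
  proof -
    have "sum gz C = (\<Sum>a\<in>A. \<Sum>z\<in>C. \<Sum>b\<in>B. p1 a * p2 b * g a b z)"
      unfolding gz_def by (rule sum.swap)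
    also have "\<dots> = (\<Sum>a\<in>A. \<Sum>b\<in>B. \<Sum>z\<in>C. p1 a * p2 b * g a b z)"
      by (intro sum.cong refl sum.swap)
    also have "\<dots> = (\<Sum>a\<in>A. \<Sum>b\<in>B. p1 a * p2 b)"
      by (simp add: sum_distrib_left[symmetric] g cong: sum.cong)
    finally show ?thesis by (simp add: sum_distrib_left[symmetric] p1 p2)
  qed
  have sum_q: "(\<Sum>a\<in>A. \<Sum>b\<in>B. \<Sum>z\<in>C. \<Sum>t\<in>D. q a b z t) = 1"
    by (simp add: q_def sum_distrib_left[symmetric] g k p1 p2 cong: sum.cong)
  have "(\<Sum>a\<in>A. \<Sum>b\<in>B. \<Sum>z\<in>C. \<Sum>t\<in>D. r a b z t)
      = (\<Sum>a\<in>A. \<Sum>z\<in>C. \<Sum>b\<in>B. \<Sum>t\<in>D. r a b z t)"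
    by (intro sum.cong refl sum.swap)
  also have "\<dots> = (\<Sum>a\<in>A. \<Sum>z\<in>C. \<Sum>t\<in>D. \<Sum>b\<in>B. r a b z t)"
    by (intro sum.cong refl sum.swap)
  \<comment> \<open>Summing the posterior of \<open>b\<close> gives \<open>ft t / ft t\<close>,
    which is 0 rather than 1 where \<open>ft t = 0\<close>. Hence \<open>r\<close> may have mass
    below 1, which only helps.\<close>
  also have "\<dots> = (\<Sum>a\<in>A. \<Sum>z\<in>C. \<Sum>t\<in>D. p1 a * k a z t * gz z * (ft t / ft t))"
    by (simp add: r_def ft_def sum_distrib_left[symmetric] sum_divide_distrib[symmetric]
        del: divide_self_if times_divide_eq_right)
  also have "\<dots> \<le> (\<Sum>a\<in>A. \<Sum>z\<in>C. \<Sum>t\<in>D. p1 a * k a z t * gz z)"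
    using p1 k gz0 by (intro sum_mono) (auto simp: divide_self_if less_imp_le)
  also have "\<dots> = (\<Sum>a\<in>A. \<Sum>z\<in>C. p1 a * gz z)"
    by (simp add: sum_distrib_left[symmetric] sum_distrib_right[symmetric] k cong: sum.cong)
  also have "\<dots> = 1"
    by (simp add: sum_distrib_left[symmetric] sum_gz p1)
  finally have sum_r: "(\<Sum>a\<in>A. \<Sum>b\<in>B. \<Sum>z\<in>C. \<Sum>t\<in>D. r a b z t) \<le> 1" .
  have "(\<Sum>a\<in>A. \<Sum>b\<in>B. \<Sum>z\<in>C. \<Sum>t\<in>D. q a b z t * ln (f b t / ft t) - q a b z t * ln (g a b z / gz z))
      \<le> (\<Sum>a\<in>A. \<Sum>b\<in>B. \<Sum>z\<in>C. \<Sum>t\<in>D. r a b z t - q a b z t)"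
    using pointwise by (intro sum_mono) auto
  also have "\<dots> \<le> 0"
    using sum_q sum_r by (simp add: sum_subtractf)
  finally show ?thesis unfolding T Z by (simp add: sum_subtractf)
qed

section \<open>Mutual information between the input and output of a channel\<close>

lemma pmf_bind_map_Pair:
  "pmf (bind_pmf M (\<lambda>v. map_pmf (\<lambda>t. (t, v)) (K v))) (t, v) = pmf M v * pmf (K v) t"
proof -
  have inj: "inj (\<lambda>t. (t, v))" for v :: 'b by (simp add: inj_on_def)
  have "pmf (map_pmf (\<lambda>t. (t, v')) (K v')) (t, v) = pmf (K v) t * indicator {v} v'" for v'
    using pmf_map_inj'[OF inj, of v "K v" t] by (auto simp: indicator_def pmf_eq_0_set_pmf)
  then show ?thesis
    by (simp add: pmf_bind measure_pmf_single)
qed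

text \<open>\<open>M\<close> is forced to be the marginal of \<open>B\<close>, so
  \<open>pmf M v\<close> cancels inside the logarithm and only the kernel and its output law
  remain.\<close>

lemma MI_eq_sum_kernel:
  fixes A :: "'o \<Rightarrow> 'a::countable" and B :: "'o \<Rightarrow> 'b::countable"
  assumes law: "map_pmf (rv_pair A B) p = bind_pmf M (\<lambda>v. map_pmf (\<lambda>t. (t, v)) (K v))"
    and fin: "finite (set_pmf M)" "finite D" and K: "\<And>v. v \<in> set_pmf M \<Longrightarrow> set_pmf (K v) \<subseteq> D"
  shows "MI p A B = (\<Sum>t\<in>D. \<Sum>v\<in>set_pmf M. pmf M v * pmf (K v) t
    * log 2 (pmf (K v) t / (\<Sum>v\<in>set_pmf M. pmf M v * pmf (K v) t)))"
proof -
  have B: "map_pmf B p = M"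
  proof -
    have "map_pmf B p = map_pmf snd (map_pmf (rv_pair A B) p)"
      by (simp add: pmf.map_comp o_def)
    then show ?thesis
      unfolding law by (simp add: map_bind_pmf pmf.map_comp o_def map_pmf_const bind_return_pmf')
  qed
  have "map_pmf A p = map_pmf fst (map_pmf (rv_pair A B) p)"
    by (simp add: pmf.map_comp o_def)
  then have "map_pmf A p = bind_pmf M K"
    unfolding law by (simp add: map_bind_pmf pmf.map_comp o_def)
  then have A: "pmf (map_pmf A p) t = (\<Sum>v\<in>set_pmf M. pmf M v * pmf (K v) t)" for t
    using fin by (simp add: pmf_bind integral_measure_pmf_real[where A = "set_pmf M"] mult.commute)
  have "A \<omega> \<in> D \<and> B \<omega> \<in> set_pmf M" if "\<omega> \<in> set_pmf p" for \<omega>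
  proof -
    have "(A \<omega>, B \<omega>) \<in> set_pmf (map_pmf (rv_pair A B) p)" using that by auto
    then show ?thesis unfolding law using K by auto
  qed
  then have "MI p A B = (\<Sum>t\<in>D. \<Sum>v\<in>set_pmf M. pmf M v * pmf (K v) t
    * log 2 (pmf M v * pmf (K v) t / (pmf (map_pmf A p) t * pmf M v)))"
    using fin MI_eq_sum[of D "set_pmf M" p A B] unfolding law pmf_bind_map_Pair B by simp
  also have "\<dots> = (\<Sum>t\<in>D. \<Sum>v\<in>set_pmf M. pmf M v * pmf (K v) t * log 2 (pmf (K v) t / pmf (map_pmf A p) t))"
    by (intro sum.cong refl) (auto simp: set_pmf_iff)
  finally show ?thesis unfolding A .
qed

section \<open>The adder channel and its joint laws\<close>

text \<open>On inputs 0 and 1, the binary symmetric channel with crossover probability 1/3. The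
  probability of output 1 is written as an affine function of \<open>y\<close> so that an unbiased
  estimate can later replace \<open>y\<close>.\<close>

definition noisy_bit :: "nat \<Rightarrow> nat pmf" where
  "noisy_bit y = map_pmf of_bool (bernoulli_pmf ((1 + real y) / 3))"

definition adder_channel :: "nat \<Rightarrow> nat \<Rightarrow> (nat \<times> nat) pmf" where
  "adder_channel x y = pair_pmf (noisy_bit y) (return_pmf (x + y))"

lemma set_noisy_bit: "set_pmf (noisy_bit y) \<subseteq> {0, 1}"
  by (auto simp: noisy_bit_def)

lemma pmf_noisy_bit:
  assumes "y \<le> 1"
  shows "pmf (noisy_bit y) 1 = (1 + real y) / 3" "pmf (noisy_bit y) 0 = (2 - real y) / 3"
proof -
  have inj: "inj (of_bool :: bool \<Rightarrow> nat)" by (auto simp: inj_on_def)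
  have "pmf (noisy_bit y) (of_bool b) = pmf (bernoulli_pmf ((1 + real y) / 3)) b" for b
    unfolding noisy_bit_def by (rule pmf_map_inj'[OF inj])
  from this[of True] this[of False] show
    "pmf (noisy_bit y) 1 = (1 + real y) / 3" "pmf (noisy_bit y) 0 = (2 - real y) / 3"
    using assms by (auto simp: field_simps)
qed

lemma wiretap_mac_adder_channel: "wiretap_mac {0, 1} {0, 1} {0, 1} {0, 1, 2} adder_channel"
  using set_noisy_bit by (auto simp: wiretap_mac_def adder_channel_def)

lemma law_V1_U:
  "map_pmf (rv_pair rvV1 rvU) (joint_law W PU PV1 PV2 PX PY)
    = bind_pmf PU (\<lambda>u. map_pmf (\<lambda>v. (v, u)) (PV1 u))"
  by (simp add: joint_law_def map_bind_pmf pmf.map_comp o_def split_beta' rvU_def rvV1_def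
      map_pmf_const) (simp add: map_pmf_def)

lemma law_V2_U:
  "map_pmf (rv_pair rvV2 rvU) (joint_law W PU PV1 PV2 PX PY)
    = bind_pmf PU (\<lambda>u. map_pmf (\<lambda>v. (v, u)) (PV2 u))"
  by (simp add: joint_law_def map_bind_pmf pmf.map_comp o_def split_beta' rvU_def rvV2_def
      map_pmf_const) (simp add: map_pmf_def)

text \<open>At a point \<open>u\<close> of positive mass, \<open>K u\<close> is the conditional law
  of \<open>A\<close> given \<open>B = u\<close>; independence makes it the unconditional
  one.\<close>

lemma indep_rv_kernel_const:
  fixes A B :: "'o \<Rightarrow> 'a::countable"
  assumes "indep_rv p A B"
    and law: "map_pmf (rv_pair A B) p = bind_pmf M (\<lambda>u. map_pmf (\<lambda>v. (v, u)) (K u))"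
    and u: "u \<in> set_pmf M"
  shows "K u = map_pmf A p"
proof (rule pmf_eqI)
  fix v
  have "map_pmf B p = map_pmf snd (map_pmf (rv_pair A B) p)"
    by (simp add: pmf.map_comp o_def)
  then have B: "map_pmf B p = M"
    unfolding law by (simp add: map_bind_pmf pmf.map_comp o_def map_pmf_const bind_return_pmf')
  have "pmf (map_pmf (rv_pair A B) p) (v, u) = pmf (map_pmf A p) v * pmf M u"
    using assms(1) by (simp add: indep_rv_iff_pair_pmf pmf_pair B)
  then show "pmf (K u) v = pmf (map_pmf A p) v"
    using u by (simp add: law pmf_bind_map_Pair set_pmf_iff)
qed

lemma joint_law_cong:
  assumes "\<And>u. u \<in> set_pmf PU \<Longrightarrow> PV1 u = PV1' u" "\<And>u. u \<in> set_pmf PU \<Longrightarrow> PV2 u = PV2' u"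
  shows "joint_law W PU PV1 PV2 PX PY = joint_law W PU PV1' PV2' PX PY"
  unfolding joint_law_def using assms by (intro bind_pmf_cong) auto

text \<open>When the kernels for V1 and V2 ignore U, U integrates out and (V1, V2) has a product
  law. X integrates out as well, because T is produced from Y alone.\<close>

lemma adder_law_T:
  "map_pmf (rv_pair rvT (rv_pair rvV1 rvV2)) (joint_law adder_channel PU (\<lambda>_. P1) (\<lambda>_. P2) PX PY)
    = bind_pmf (pair_pmf P1 P2) (\<lambda>v. map_pmf (\<lambda>t. (t, v)) (bind_pmf (PY (snd v)) noisy_bit))"
  by (simp add: joint_law_def adder_channel_def map_bind_pmf pmf.map_comp o_def split_beta' rvT_def
      rvV1_def rvV2_def pair_pmf_def bind_assoc_pmf bind_return_pmf bind_pmf_const)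
    (simp add: map_pmf_def)

lemma adder_law_Z:
  "map_pmf (rv_pair rvZ (rv_pair rvV1 rvV2)) (joint_law adder_channel PU (\<lambda>_. P1) (\<lambda>_. P2) PX PY)
    = bind_pmf (pair_pmf P1 P2) (\<lambda>v. map_pmf (\<lambda>z. (z, v))
        (bind_pmf (PX (fst v)) (\<lambda>x. bind_pmf (PY (snd v)) (\<lambda>y. return_pmf (x + y)))))"
  by (simp add: joint_law_def adder_channel_def map_bind_pmf pmf.map_comp o_def split_beta' rvZ_def
      rvV1_def rvV2_def pair_pmf_def bind_assoc_pmf bind_return_pmf bind_pmf_const)

section \<open>Degradation without conferencing\<close>

text \<open>
  Since \<open>Z - q\<close> has mean \<open>y\<close> given \<open>Y = y\<close>, this output is \<open>1\<close> with probability
  \<open>(1 + y) / 3\<close>; the crossover probability 1/3 keeps \<open>(1 + z - q) / 3\<close> within [0, 1].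
\<close>
definition degrading_kernel :: "real \<Rightarrow> nat \<Rightarrow> nat \<Rightarrow> real" where
  "degrading_kernel q z t = (if t = 1 then 1 + real z - q else 2 - real z + q) / 3"

lemma pmf_0_eq:
  fixes P :: "nat pmf"
  assumes "set_pmf P \<subseteq> {0, 1}"
  shows "pmf P 0 = 1 - pmf P 1"
  using sum_pmf_eq_1[OF _ assms] by simp

lemma set_adder:
  assumes "set_pmf X \<subseteq> {0, 1}" "set_pmf Y \<subseteq> {0, 1}"
  shows "set_pmf (bind_pmf X (\<lambda>x. bind_pmf Y (\<lambda>y. return_pmf (x + y)))) \<subseteq> {0, 1, 2 :: nat}"
proof
  fix z assume "z \<in> set_pmf (bind_pmf X (\<lambda>x. bind_pmf Y (\<lambda>y. return_pmf (x + y))))"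
  then obtain x y where "x \<in> set_pmf X" "y \<in> set_pmf Y" "z = x + y" by auto
  with assms have "x = 0 \<or> x = 1" "y = 0 \<or> y = 1" by auto
  with \<open>z = x + y\<close> show "z \<in> {0, 1, 2}" by auto
qed

text \<open>The kernel is affine in \<open>z\<close>, so its average depends on the output only
  through the mean E X + E Y. Subtracting E X = \<open>pmf X 1\<close> leaves (1 + E Y) / 3 for
  \<open>t = 1\<close>. In use, \<open>X\<close> and \<open>Y\<close> are the input laws for fixed
  values of V1 and V2.\<close>

lemma noisy_bit_degraded:
  assumes X: "set_pmf X \<subseteq> {0, 1}" and Y: "set_pmf Y \<subseteq> {0, 1}" and t: "t \<in> {0, 1}"
  shows "pmf (bind_pmf Y noisy_bit) t
    = (\<Sum>z\<in>{0, 1, 2}. pmf (bind_pmf X (\<lambda>x. bind_pmf Y (\<lambda>y. return_pmf (x + y)))) z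
        * degrading_kernel (pmf X 1) z t)"
proof -
  have eX: "(\<integral>x. f x \<partial>measure_pmf X) = f 0 * (1 - pmf X 1) + f 1 * pmf X 1" for f :: "nat \<Rightarrow> real"
    using X by (subst integral_measure_pmf_real[where A = "{0, 1}"]) (auto simp: pmf_0_eq)
  have eY: "(\<integral>y. f y \<partial>measure_pmf Y) = f 0 * (1 - pmf Y 1) + f 1 * pmf Y 1" for f :: "nat \<Rightarrow> real"
    using Y by (subst integral_measure_pmf_real[where A = "{0, 1}"]) (auto simp: pmf_0_eq)
  have n: "pmf (noisy_bit 0) 0 = 2/3" "pmf (noisy_bit 0) 1 = 1/3"
    "pmf (noisy_bit 1) 0 = 1/3" "pmf (noisy_bit 1) 1 = 2/3"
    using pmf_noisy_bit[of 0] pmf_noisy_bit[of 1] by auto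
  show ?thesis
    using t by (auto simp: pmf_bind eX eY n pmf_return degrading_kernel_def indicator_def field_simps
      simp del: One_nat_def)
qed

lemma adder_independent_le:
  assumes fin: "finite (set_pmf P1)" "finite (set_pmf P2)"
    and PX: "\<And>v. v \<in> set_pmf P1 \<Longrightarrow> set_pmf (PX v) \<subseteq> {0, 1}"
    and PY: "\<And>v. v \<in> set_pmf P2 \<Longrightarrow> set_pmf (PY v) \<subseteq> {0, 1}"
    and p: "p = joint_law adder_channel PU (\<lambda>_. P1) (\<lambda>_. P2) PX PY"
  shows "t012 p \<le> z012 p"
proof -
  define f where "f b t = pmf (bind_pmf (PY b) noisy_bit) t" for b t
  define g where "g a b z = pmf (bind_pmf (PX a) (\<lambda>x. bind_pmf (PY b) (\<lambda>y. return_pmf (x + y)))) z"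
    for a b z
  let ?A = "set_pmf P1" and ?B = "set_pmf P2"
  have sum1: "(\<Sum>a\<in>?A. pmf P1 a) = 1" "(\<Sum>b\<in>?B. pmf P2 b) = 1"
    using fin by (auto intro: sum_pmf_eq_1)
  \<comment> \<open>\<open>MI\<close> is in bits whereas \<open>degraded_sum_le\<close> uses natural
    logarithms, whence the factor \<open>ln 2\<close>.\<close>
  have T: "t012 p = (\<Sum>t\<in>{0, 1}. \<Sum>a\<in>?A. \<Sum>b\<in>?B. pmf P1 a * pmf P2 b * f b t
      * ln (f b t / (\<Sum>b\<in>?B. pmf P2 b * f b t))) / ln 2"
  proof -
    have "t012 p = (\<Sum>t\<in>{0, 1}. \<Sum>v\<in>set_pmf (pair_pmf P1 P2). pmf (pair_pmf P1 P2) v * f (snd v) t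
      * log 2 (f (snd v) t / (\<Sum>v\<in>set_pmf (pair_pmf P1 P2). pmf (pair_pmf P1 P2) v * f (snd v) t)))"
      unfolding t012_def f_def
    proof (rule MI_eq_sum_kernel[OF adder_law_T[of PU P1 P2 PX PY, folded p]])
      show "set_pmf (bind_pmf (PY (snd v)) noisy_bit) \<subseteq> {0, 1}" for v :: "int \<times> int"
        using set_noisy_bit by fastforce
    qed (use fin in auto)
    also have "\<dots> = (\<Sum>t\<in>{0, 1}. \<Sum>a\<in>?A. \<Sum>b\<in>?B. pmf P1 a * pmf P2 b * f b t
      * log 2 (f b t / (\<Sum>a\<in>?A. \<Sum>b\<in>?B. pmf P1 a * pmf P2 b * f b t)))"
      by (simp only: set_pair_pmf sum.cartesian_product' pmf_pair snd_conv)
    \<comment> \<open>The output law of T averages over V2 only: \<open>f\<close> ignores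
      \<open>a\<close>, and the weights of \<open>P1\<close> sum to 1.\<close>
    also have "(\<lambda>t. \<Sum>a\<in>?A. \<Sum>b\<in>?B. pmf P1 a * pmf P2 b * f b t) = (\<lambda>t. \<Sum>b\<in>?B. pmf P2 b * f b t)"
      by (simp add: mult.assoc sum_distrib_left[symmetric] sum_distrib_right[symmetric] sum1)
    finally show ?thesis by (simp only: log_def sum_divide_distrib times_divide_eq_right)
  qed
  have Z: "z012 p = (\<Sum>z\<in>{0, 1, 2}. \<Sum>a\<in>?A. \<Sum>b\<in>?B. pmf P1 a * pmf P2 b * g a b z
      * ln (g a b z / (\<Sum>a\<in>?A. \<Sum>b\<in>?B. pmf P1 a * pmf P2 b * g a b z))) / ln 2"
  proof -
    have "z012 p = (\<Sum>z\<in>{0, 1, 2}. \<Sum>v\<in>set_pmf (pair_pmf P1 P2). pmf (pair_pmf P1 P2) v * g (fst v) (snd v) z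
      * log 2 (g (fst v) (snd v) z
          / (\<Sum>v\<in>set_pmf (pair_pmf P1 P2). pmf (pair_pmf P1 P2) v * g (fst v) (snd v) z)))"
      unfolding z012_def g_def
    proof (rule MI_eq_sum_kernel[OF adder_law_Z[of PU P1 P2 PX PY, folded p]])
      show "set_pmf (bind_pmf (PX (fst v)) (\<lambda>x. bind_pmf (PY (snd v)) (\<lambda>y. return_pmf (x + y)))) \<subseteq> {0, 1, 2}"
        if "v \<in> set_pmf (pair_pmf P1 P2)" for v :: "int \<times> int"
        using that by (intro set_adder PX PY) auto
    qed (use fin in auto)
    also have "\<dots> = (\<Sum>z\<in>{0, 1, 2}. \<Sum>a\<in>?A. \<Sum>b\<in>?B. pmf P1 a * pmf P2 b * g a b z
      * log 2 (g a b z / (\<Sum>a\<in>?A. \<Sum>b\<in>?B. pmf P1 a * pmf P2 b * g a b z)))"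
      by (simp only: set_pair_pmf sum.cartesian_product' pmf_pair fst_conv snd_conv)
    finally show ?thesis by (simp only: log_def sum_divide_distrib times_divide_eq_right)
  qed
  have "(\<Sum>t\<in>{0, 1}. \<Sum>a\<in>?A. \<Sum>b\<in>?B. pmf P1 a * pmf P2 b * f b t
        * ln (f b t / (\<Sum>b\<in>?B. pmf P2 b * f b t)))
      \<le> (\<Sum>z\<in>{0, 1, 2}. \<Sum>a\<in>?A. \<Sum>b\<in>?B. pmf P1 a * pmf P2 b * g a b z
        * ln (g a b z / (\<Sum>a\<in>?A. \<Sum>b\<in>?B. pmf P1 a * pmf P2 b * g a b z)))"
  \<comment> \<open>The kernel may depend on the value \<open>a\<close> of V1 but not on
    \<open>b\<close>; its parameter is P(X = 1 | V1 = a).\<close>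
  proof (rule degraded_sum_le[where k = "\<lambda>a. degrading_kernel (pmf (PX a) 1)"])
    fix a b assume "a \<in> ?A" "b \<in> ?B"
    then show "(\<Sum>z\<in>{0, 1, 2}. g a b z) = 1"
      unfolding g_def by (intro sum_pmf_eq_1 set_adder PX PY) auto
  next
    fix a b and t :: nat assume "a \<in> ?A" "b \<in> ?B" "t \<in> {0, 1}"
    then show "f b t = (\<Sum>z\<in>{0, 1, 2}. g a b z * degrading_kernel (pmf (PX a) 1) z t)"
      unfolding f_def g_def by (intro noisy_bit_degraded PX PY)
  next
    fix a and z t :: nat assume "z \<in> {0, 1, 2}" "t \<in> {0, 1}"
    then show "0 \<le> degrading_kernel (pmf (PX a) 1) z t"
      using pmf_le_1[of "PX a" 1] by (auto simp: degrading_kernel_def)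
  next
    fix a and z :: nat
    show "(\<Sum>t\<in>{0, 1}. degrading_kernel (pmf (PX a) 1) z t) = 1"
      by (simp add: degrading_kernel_def field_simps)
  qed (use fin sum1 in \<open>auto simp: g_def pmf_positive\<close>)
  then show ?thesis unfolding T Z by (rule divide_right_mono) simp
qed

lemma Pi0_adder_le:
  assumes "p \<in> Pi0 {0, 1} {0, 1} adder_channel"
  shows "t012 p \<le> z012 p"
proof -
  from assms obtain PU PV1 PV2 PX PY \<U> \<V>\<^sub>1 \<V>\<^sub>2
    where p: "p = joint_law adder_channel PU PV1 PV2 PX PY"
      and fin: "finite \<V>\<^sub>1" "finite \<V>\<^sub>2"
      and U: "set_pmf PU \<subseteq> \<U>"
      and V: "\<And>u. u \<in> \<U> \<Longrightarrow> set_pmf (PV1 u) \<subseteq> \<V>\<^sub>1 \<and> set_pmf (PV2 u) \<subseteq> \<V>\<^sub>2"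
      and PX: "\<And>v. v \<in> \<V>\<^sub>1 \<Longrightarrow> set_pmf (PX v) \<subseteq> {0, 1}"
      and PY: "\<And>v. v \<in> \<V>\<^sub>2 \<Longrightarrow> set_pmf (PY v) \<subseteq> {0, 1}"
      and ind: "indep_rv p rvV1 rvU" "indep_rv p rvV2 rvU"
    unfolding Pi0_def Pi_set_def by auto
  let ?P1 = "map_pmf rvV1 p" and ?P2 = "map_pmf rvV2 p"
  \<comment> \<open>V1 and V2 are conditionally independent given U by construction. Each being
    independent of U makes its kernel constant on the support of \<open>PU\<close>, and so V1 and V2
    are independent of each other.\<close>
  have eq: "PV1 u = ?P1" "PV2 u = ?P2" if "u \<in> set_pmf PU" for u
    using indep_rv_kernel_const[OF ind(1) law_V1_U[of adder_channel PU PV1 PV2 PX PY, folded p] that]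
      indep_rv_kernel_const[OF ind(2) law_V2_U[of adder_channel PU PV1 PV2 PX PY, folded p] that] by auto
  then have p': "p = joint_law adder_channel PU (\<lambda>_. ?P1) (\<lambda>_. ?P2) PX PY"
    by (intro trans[OF p joint_law_cong])
  obtain u where u: "u \<in> set_pmf PU" using set_pmf_not_empty[of PU] by blast
  then have "u \<in> \<U>" using U by blast
  then have sub: "set_pmf ?P1 \<subseteq> \<V>\<^sub>1" "set_pmf ?P2 \<subseteq> \<V>\<^sub>2"
    using V[of u] unfolding eq[OF u] by blast+
  show ?thesis
  proof (rule adder_independent_le[OF _ _ _ _ p'])
    show "finite (set_pmf ?P1)" "finite (set_pmf ?P2)"
      using sub fin finite_subset by blast+
  qed (use sub PX PY in blast)+
qed

lemma Pi0_region_zero: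
  assumes "p \<in> Pi0 {0, 1} {0, 1} adder_channel"
  shows "Region0 p \<subseteq> {(0, 0)}"
  using Pi0_adder_le[OF assms] by (auto simp: Region0_def t012_def z012_def)

lemma joint_law_in_Pi_set:
  assumes "finite \<U>" "finite \<V>\<^sub>1" "finite \<V>\<^sub>2" "set_pmf PU \<subseteq> \<U>"
    and "\<And>u. u \<in> \<U> \<Longrightarrow> set_pmf (PV1 u) \<subseteq> \<V>\<^sub>1" "\<And>u. u \<in> \<U> \<Longrightarrow> set_pmf (PV2 u) \<subseteq> \<V>\<^sub>2"
    and "\<And>v. v \<in> \<V>\<^sub>1 \<Longrightarrow> set_pmf (PX v) \<subseteq> \<X>" "\<And>v. v \<in> \<V>\<^sub>2 \<Longrightarrow> set_pmf (PY v) \<subseteq> \<Y>"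
  shows "joint_law W PU PV1 PV2 PX PY \<in> Pi_set \<X> \<Y> W"
  unfolding Pi_set_def mem_Collect_eq
  by (rule exI[of _ PU], rule exI[of _ PV1], rule exI[of _ PV2], rule exI[of _ PX], rule exI[of _ PY],
      rule conjI[OF refl], rule exI[of _ \<U>], rule exI[of _ \<V>\<^sub>1], rule exI[of _ \<V>\<^sub>2])
    (use assms in auto)

text \<open>The region has to equal {(0, 0)}, so the union must also be nonempty. This law, with U,
  V1, V2 constant, puts (0, 0) into it.\<close>

definition constant_law :: "outcome pmf" where
  "constant_law = joint_law adder_channel (return_pmf 0) (\<lambda>_. return_pmf 0) (\<lambda>_. return_pmf 0)
     (\<lambda>_. return_pmf 0) (\<lambda>_. return_pmf 0)"

lemma constant_law_support:
  assumes "\<omega> \<in> set_pmf constant_law"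
  shows "rvV1 \<omega> = 0" "rvV2 \<omega> = 0"
  using assms
  by (auto simp: constant_law_def joint_law_def bind_return_pmf rvV1_def rvV2_def)

lemma finite_constant_law: "finite (set_pmf constant_law)"
  by (auto simp: constant_law_def joint_law_def bind_return_pmf adder_channel_def
      intro: finite_subset[OF set_noisy_bit])

lemma constant_law_MI:
  "MI constant_law (A :: _ \<Rightarrow> nat) rvV1 = 0" "MI constant_law A rvV2 = 0"
  "MI constant_law A (rv_pair rvV1 rvV2) = 0" "MI constant_law A (rv_pair rvV2 rvV1) = 0"
  using finite_constant_law constant_law_support by (auto intro: MI_const_right)

lemma constant_law_in_Pi0: "constant_law \<in> Pi0 {0, 1} {0, 1} adder_channel"
proof -
  have "constant_law \<in> Pi_set {0, 1} {0, 1} adder_channel"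
    unfolding constant_law_def
    by (rule joint_law_in_Pi_set[where \<U> = "{0}" and \<V>\<^sub>1 = "{0}" and \<V>\<^sub>2 = "{0}"]) auto
  moreover have "indep_rv constant_law rvV1 rvU" "indep_rv constant_law rvV2 rvU"
    using constant_law_support by (auto intro: indep_rv_const_left)
  ultimately show ?thesis
    by (simp add: Pi0_def t012_def z012_def CMI_eq_MI_diff constant_law_MI)
qed

lemma region_without_conferencing_adder:
  "region_without_conferencing {0, 1} {0, 1} adder_channel = {(0, 0)}"
proof -
  have "(0, 0) \<in> Region0 constant_law"
    by (simp add: Region0_def CMI_eq_MI_diff constant_law_MI pos_part_def)
  then have "(\<Union>p\<in>Pi0 {0, 1} {0, 1} adder_channel. Region0 p) = {(0, 0)}"
    using Pi0_region_zero constant_law_in_Pi0 by blast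
  then show ?thesis
    by (simp add: region_without_conferencing_def)
qed

section \<open>A positive rate with conferencing\<close>

text \<open>U is a fair bit shared by the senders, X = V1 = U and Y = V2 = 1 - U. The inputs are
  opposite while the product form over U required by \<open>Pi_set\<close> is kept.\<close>

definition complementary_law :: "outcome pmf" where
  "complementary_law = joint_law adder_channel (pmf_of_set {0, 1}) return_pmf (\<lambda>u. return_pmf (1 - u))
     (\<lambda>v. return_pmf (nat v)) (\<lambda>v. return_pmf (nat v))"

lemma complementary_law_eq:
  "complementary_law = bind_pmf (pmf_of_set {0, 1}) (\<lambda>u. map_pmf
     (\<lambda>t. (u, u, 1 - u, nat u, nat (1 - u), t, nat u + nat (1 - u))) (noisy_bit (nat (1 - u))))"
  by (simp add: complementary_law_def joint_law_def bind_return_pmf adder_channel_def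
      pair_pmf_def map_bind_pmf) (simp add: map_pmf_def)

lemma complementary_law_support:
  assumes "\<omega> \<in> set_pmf complementary_law"
  shows "rvV1 \<omega> = rvU \<omega>" "rvV2 \<omega> = 1 - rvU \<omega>" "rvZ \<omega> = 1"
  using assms by (auto simp: complementary_law_eq rvU_def rvV1_def rvV2_def rvZ_def)

lemma finite_complementary_law: "finite (set_pmf complementary_law)"
  by (auto simp: complementary_law_eq intro: finite_subset[OF set_noisy_bit])

lemma complementary_law_in_Pi_set: "complementary_law \<in> Pi_set {0, 1} {0, 1} adder_channel"
  unfolding complementary_law_def
  by (rule joint_law_in_Pi_set[where \<U> = "{0, 1}" and \<V>\<^sub>1 = "{0, 1}" and \<V>\<^sub>2 = "{0, 1}"]) auto

lemma complementary_law_MI_T: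
  fixes f :: "int \<Rightarrow> 'b::countable"
  assumes "inj f" "\<And>\<omega>. rvV1 \<omega> = rvU \<omega> \<Longrightarrow> rvV2 \<omega> = 1 - rvU \<omega> \<Longrightarrow> B \<omega> = f (rvU \<omega>)"
  shows "MI complementary_law rvT B = MI complementary_law rvT rvU"
  using assms complementary_law_support
  by (intro MI_inj_image[OF finite_complementary_law assms(1)]) auto

text \<open>V1 and V2 are functions of U, so nothing is left to learn once U is given. The
  information in T enters only through \<open>t012\<close>, and the individual rates must come from
  the conferencing capacities.\<close>

lemma complementary_law_t:
  "t1 complementary_law = 0" "t2 complementary_law = 0" "t12 complementary_law = 0"
  "t012 complementary_law = MI complementary_law rvT rvU"
proof -
  note eqs =
    complementary_law_MI_T[of "\<lambda>u. (u, 1 - u, u)" "rv_pair rvV1 (rv_pair rvV2 rvU)"]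
    complementary_law_MI_T[of "\<lambda>u. (1 - u, u, u)" "rv_pair rvV2 (rv_pair rvV1 rvU)"]
    complementary_law_MI_T[of "\<lambda>u. (1 - u, u)" "rv_pair rvV2 rvU"]
    complementary_law_MI_T[of "\<lambda>u. (u, u)" "rv_pair rvV1 rvU"]
    complementary_law_MI_T[of "\<lambda>u. ((u, 1 - u), u)" "rv_pair (rv_pair rvV1 rvV2) rvU"]
    complementary_law_MI_T[of "\<lambda>u. (u, 1 - u)" "rv_pair rvV1 rvV2"]
  show
    "t1 complementary_law = 0" "t2 complementary_law = 0" "t12 complementary_law = 0"
    "t012 complementary_law = MI complementary_law rvT rvU"
    by (simp_all add: t1_def t2_def t12_def t012_def CMI_eq_MI_diff eqs inj_on_def)
qed

text \<open>A fair bit is sent through the symmetric channel with crossover 1/3, so the value is 1 -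
  h(1/3) with h the binary entropy. Collecting the logarithms gives a third of the logarithm of
  (2/3)(4/3)(4/3) = 32/27 > 1.\<close>

lemma complementary_law_MI_T_U_pos: "0 < MI complementary_law rvT rvU"
proof -
  have law: "map_pmf (rv_pair rvT rvU) complementary_law
    = bind_pmf (pmf_of_set {0, 1}) (\<lambda>u. map_pmf (\<lambda>t. (t, u)) (noisy_bit (nat (1 - u))))"
    by (simp add: complementary_law_eq map_bind_pmf pmf.map_comp o_def rvT_def rvU_def)
  have n: "pmf (noisy_bit 0) 0 = 2/3" "pmf (noisy_bit 0) (Suc 0) = 1/3"
    "pmf (noisy_bit (Suc 0)) 0 = 1/3" "pmf (noisy_bit (Suc 0)) (Suc 0) = 2/3"
    using pmf_noisy_bit[of 0] pmf_noisy_bit[of 1] by auto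
  have "MI complementary_law rvT rvU = log 2 (2/3) / 3 + 2 * log 2 (4/3) / 3"
    using set_noisy_bit
    by (subst MI_eq_sum_kernel[OF law, where D = "{0, 1}"]) (auto simp: n)
  also have "\<dots> = log 2 (32/27) / 3"
    using log_mult_pos[of "2/3" "4/3 * (4/3)" 2] log_mult_pos[of "4/3" "4/3" 2] by simp
  also have "\<dots> > 0" by simp
  finally show ?thesis .
qed

lemma complementary_law_z012: "z012 complementary_law = 0"
  unfolding z012_def
  by (rule MI_const_left[OF finite_complementary_law complementary_law_support(3)])

lemma region_with_conferencing_adder:
  assumes "0 < C1" "0 < C2"
  shows "\<exists>R \<in> region_with_conferencing {0, 1} {0, 1} adder_channel C1 C2. R \<noteq> (0, 0)"
proof
  \<comment> \<open>With \<open>t1\<close>, \<open>t2\<close>, \<open>t12\<close> and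
    \<open>z012\<close> all zero, the third region reads R1 \<le> C1, R2 \<le> C2 and R1 + R2 \<le>
    min (C1 + C2) t012; this is its largest point on the R1 axis.\<close>
  let ?R = "(min C1 (t012 complementary_law), 0 :: real)"
  have pos: "0 < t012 complementary_law"
    by (simp add: complementary_law_t complementary_law_MI_T_U_pos)
  then show "?R \<noteq> (0, 0)" using assms by auto
  have "complementary_law \<in> Pi3 {0, 1} {0, 1} adder_channel (C1 + C2)"
    using pos assms complementary_law_in_Pi_set
    by (simp add: Pi3_def complementary_law_z012)
  moreover have "?R \<in> Region3 complementary_law C1 C2"
    using pos assms by (simp add: Region3_def complementary_law_t(1-3) complementary_law_z012 pos_part_def)
  ultimately show "?R \<in> region_with_conferencing {0, 1} {0, 1} adder_channel C1 C2"
    unfolding region_with_conferencing_def by (intro subsetD[OF closure_subset] hull_inc) blast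
qed

theorem mainTheorem3:
  shows "\<exists>\<X> \<Y> \<T> \<Z> W.
    wiretap_mac \<X> \<Y> \<T> \<Z> W \<and>
    region_without_conferencing \<X> \<Y> W = {(0, 0)} \<and>
    (\<forall>C1 C2. 0 < C1 \<and> 0 < C2 \<longrightarrow>
       (\<exists>R \<in> region_with_conferencing \<X> \<Y> W C1 C2. R \<noteq> (0, 0)))"
  using wiretap_mac_adder_channel region_without_conferencing_adder region_with_conferencing_adder
  by blast

end
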